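(* Let $G=(V,E)$ be a finite $d$-regular graph ($d\ge1$), let $\lambda_N$ be the largest eigenvalue of its normalized Laplacian and $t_1$ the smallest eigenvalue of its normalized adjacency matrix. Then $$2-\lambda_N=1+t_1\ \ge\ \frac{\left(\sqrt{1+\beta_{out}}-1\right)^2}{2d},$$ where $\beta_{out}$ is the outer vertex bipartiteness constant of $G$.
   Context: Graphs are undirected and may contain self-loops; $x\sim y$ means $\{x,y\}\in E$ ($x\sim x$ if there is a self-loop at $x$). The degree of $x$ is $|\{y: y\sim x\}|$ (a self-loop counts once). For a $d$-regular graph the normalized adjacency matrix is $\frac1dA$, with $A_{xy}=1$ if $x\sim y$ and $0$ otherwise, and the normalized Laplacian is $I-\frac1dA$. For $V_1\subseteq V$, $\partial_{out}(V_1)=\{y\in V\setminus V_1:\exists\,x\in V_1,\ x\sim y\}$. For $L\subseteq V$, $I(L)=|\{x\in L:\exists\,y\in L,\ y\sim x\}|$. The outer vertex bipartiteness constant is $$\beta_{out}=\min_{L,R\subseteq V,\ L\cap R=\emptyset,\ L\cup R\ne\emptyset}\frac{I(L)+I(R)+|\partial_{out}(L\cup R)|}{|L\cup R|}.$$ *)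

theory Defs
  imports "HOL-Analysis.Analysis"
begin

text \<open>
  The vertex set is the whole of a finite type \<open>'v\<close>. An edge is an unordered pair \<open>{x, y}\<close>;
  a self-loop at \<open>x\<close> is the singleton \<open>{x} = {x, x}\<close>.
\<close>

definition loop_graph :: "'v set set \<Rightarrow> bool" where
  "loop_graph E \<longleftrightarrow> (\<forall>e\<in>E. \<exists>x y. e = {x, y})"

definition adj :: "'v set set \<Rightarrow> 'v \<Rightarrow> 'v \<Rightarrow> bool" where
  "adj E x y \<longleftrightarrow> {x, y} \<in> E"

definition vertex_degree :: "'v set set \<Rightarrow> 'v \<Rightarrow> nat" where
  "vertex_degree E x = card {y. adj E y x}"

definition regular_graph :: "'v set set \<Rightarrow> nat \<Rightarrow> bool" where
  "regular_graph E d \<longleftrightarrow> (\<forall>x. vertex_degree E x = d)"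

definition adj_matrix :: "'v::finite set set \<Rightarrow> real ^ 'v ^ 'v" where
  "adj_matrix E = (\<chi> x y. if adj E x y then 1 else 0)"

definition norm_adj_matrix :: "'v::finite set set \<Rightarrow> nat \<Rightarrow> real ^ 'v ^ 'v" where
  "norm_adj_matrix E d = (1 / real d) *\<^sub>R adj_matrix E"

definition norm_laplacian :: "'v::finite set set \<Rightarrow> nat \<Rightarrow> real ^ 'v ^ 'v" where
  "norm_laplacian E d = mat 1 - norm_adj_matrix E d"

definition eigenvalue :: "real ^ 'n ^ 'n \<Rightarrow> real \<Rightarrow> bool" where
  "eigenvalue M \<mu> \<longleftrightarrow> (\<exists>v. v \<noteq> 0 \<and> M *v v = \<mu> *\<^sub>R v)"

text \<open>
  These two are only meant for symmetric matrices, all of whose (complex) eigenvalues are real,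
  so that the sets below are finite and nonempty.
\<close>

definition largest_eigenvalue :: "real ^ 'n ^ 'n \<Rightarrow> real" where
  "largest_eigenvalue M = Max {\<mu>. eigenvalue M \<mu>}"

definition smallest_eigenvalue :: "real ^ 'n ^ 'n \<Rightarrow> real" where
  "smallest_eigenvalue M = Min {\<mu>. eigenvalue M \<mu>}"

definition outer_boundary :: "'v set set \<Rightarrow> 'v set \<Rightarrow> 'v set" where
  "outer_boundary E S = {y. y \<notin> S \<and> (\<exists>x\<in>S. adj E x y)}"

definition non_isolated_count :: "'v set set \<Rightarrow> 'v set \<Rightarrow> nat" where
  "non_isolated_count E L = card {x\<in>L. \<exists>y\<in>L. adj E y x}"

definition beta_out :: "'v::finite set set \<Rightarrow> real" where
  "beta_out E = Min {real (non_isolated_count E L + non_isolated_count E R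
      + card (outer_boundary E (L \<union> R))) / real (card (L \<union> R)) | L R.
      L \<inter> R = {} \<and> L \<union> R \<noteq> {}}"

end

theory Submission
  imports Defs
begin

text \<open>
  Let \<open>f\<close> be an eigenvector for \<open>t\<^sub>1\<close>; then \<open>\<Sum>\<^bsub>x \<sim> y\<^esub> (f x + f y)\<^sup>2 = 2 d (1 + t\<^sub>1) \<Sum> (f x)\<^sup>2\<close>.
  Apply the definition of \<open>\<beta>\<^sub>o\<^sub>u\<^sub>t\<close> to the level sets \<open>L = {f > 0, f\<^sup>2 > t}\<close>, \<open>R = {f < 0, f\<^sup>2 > t}\<close>
  and integrate over \<open>t \<ge> 0\<close>. This bounds \<open>\<beta>\<^sub>o\<^sub>u\<^sub>t \<Sum> (f x)\<^sup>2\<close> by a sum of local terms, and the term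
  at \<open>x\<close> is at most \<open>D\<^sup>2 + 2 \<bar>f x\<bar> D\<close> where \<open>D\<^sup>2 = \<Sum>\<^bsub>y \<sim> x\<^esub> (f x + f y)\<^sup>2\<close>. Cauchy--Schwarz and
  completing the square give the result.
\<close>

section \<open>Eigenvalues of symmetric matrices\<close>

lemma inner_symmetric_matrix:
  fixes M :: "real ^ 'n ^ 'n"
  assumes "transpose M = M"
  shows "x \<bullet> (M *v y) = (M *v x) \<bullet> y"
  by (metis assms dot_lmul_matrix transpose_matrix_vector)

text \<open>Eigenvectors for distinct eigenvalues are orthogonal by symmetry, and a pairwise
  orthogonal set of vectors is finite. Choosing one eigenvector per eigenvalue is injective, so
  finiteness carries back to the eigenvalues.\<close>

lemma finite_eigenvalues_symmetric:
  fixes M :: "real ^ 'n ^ 'n"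
  assumes "transpose M = M"
  shows "finite {\<mu>. eigenvalue M \<mu>}"
proof -
  define v where "v \<mu> = (SOME v. v \<noteq> 0 \<and> M *v v = \<mu> *\<^sub>R v)" for \<mu>
  have v: "v \<mu> \<noteq> 0" "M *v v \<mu> = \<mu> *\<^sub>R v \<mu>" if "eigenvalue M \<mu>" for \<mu>
    using someI_ex[of "\<lambda>v. v \<noteq> 0 \<and> M *v v = \<mu> *\<^sub>R v"] that
    unfolding eigenvalue_def v_def by blast+
  have orth: "v \<mu> \<bullet> v \<nu> = 0" if "eigenvalue M \<mu>" "eigenvalue M \<nu>" "\<mu> \<noteq> \<nu>" for \<mu> \<nu>
    using inner_symmetric_matrix[OF assms, of "v \<mu>" "v \<nu>"] v[OF that(1)] v[OF that(2)] that(3)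
    by simp
  have "pairwise orthogonal (v ` {\<mu>. eigenvalue M \<mu>})"
    by (auto simp: pairwise_def orthogonal_def intro!: orth)
  hence "finite (v ` {\<mu>. eigenvalue M \<mu>})"
    by (rule pairwise_orthogonal_imp_finite)
  moreover have "inj_on v {\<mu>. eigenvalue M \<mu>}"
  proof (rule inj_onI, rule ccontr)
    fix \<mu> \<nu> assume "\<mu> \<in> {\<mu>. eigenvalue M \<mu>}" "\<nu> \<in> {\<mu>. eigenvalue M \<mu>}" "v \<mu> = v \<nu>" "\<mu> \<noteq> \<nu>"
    with orth[of \<mu> \<nu>] v(1)[of \<mu>] show False by simp
  qed
  ultimately show ?thesis by (rule finite_imageD)
qed

text \<open>A minimiser \<open>v\<close> of the quadratic form on the unit sphere is an eigenvector:
  if the residual \<open>r\<close> were nonzero, a small step from \<open>v\<close> against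
  \<open>r\<close> would make the nonnegative form \<open>Q\<close> negative.\<close>

lemma eigenvalue_symmetric_exists:
  fixes M :: "real ^ 'n ^ 'n"
  assumes sym: "transpose M = M"
  shows "\<exists>\<mu>. eigenvalue M \<mu>"
proof -
  have "continuous_on (sphere 0 1) (\<lambda>v. v \<bullet> (M *v v))"
    by (intro continuous_intros)
  moreover have "sphere (0 :: real ^ 'n) 1 \<noteq> {}" by simp
  ultimately obtain v where v: "norm v = 1"
    and min: "\<And>w. norm w = 1 \<Longrightarrow> v \<bullet> (M *v v) \<le> w \<bullet> (M *v w)"
    using continuous_attains_inf[OF compact_sphere, of 0 1 "\<lambda>v. v \<bullet> (M *v v)"] by fastforce
  define c where "c = v \<bullet> (M *v v)"
  define Q where "Q w = w \<bullet> (M *v w) - c * (w \<bullet> w)" for w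
  define r where "r = M *v v - c *\<^sub>R v"
  have Q_nonneg: "Q w \<ge> 0" for w
  proof (cases "w = 0")
    case False
    have "c \<le> (w /\<^sub>R norm w) \<bullet> (M *v (w /\<^sub>R norm w))"
      unfolding c_def by (rule min) (use False in simp)
    also have "\<dots> = (w \<bullet> (M *v w)) / (norm w)\<^sup>2"
      by (simp add: matrix_vector_mult_scaleR power2_eq_square divide_inverse)
    finally show ?thesis
      using False by (simp add: Q_def field_simps power2_norm_eq_inner)
  qed (simp add: Q_def)
  have vv: "v \<bullet> v = 1" using v by (simp add: norm_eq_1)
  have Mv: "M *v v = r + c *\<^sub>R v" by (simp add: r_def)
  \<comment> \<open>There is no constant term because \<open>Q v = 0\<close>, and the linear term is
    \<open>r \<bullet> r\<close> because \<open>r\<close> is orthogonal to \<open>v\<close>.\<close>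
  have expand: "Q (v - s *\<^sub>R r) = s\<^sup>2 * Q r - 2 * s * (r \<bullet> r)" for s
  proof -
    have "v \<bullet> (M *v r) = (r + c *\<^sub>R v) \<bullet> r"
      using inner_symmetric_matrix[OF sym, of v r] Mv by simp
    moreover have "r \<bullet> v = 0"
      using vv by (simp add: r_def inner_diff_left inner_diff_right c_def inner_commute)
    ultimately show ?thesis
      using vv by (simp add: Q_def matrix_vector_mult_diff_distrib matrix_vector_mult_scaleR Mv
          inner_diff_left inner_diff_right inner_add_left inner_add_right inner_commute
          power2_eq_square algebra_simps)
  qed
  have "r = 0"
  proof (rule ccontr)
    assume "r \<noteq> 0"
    hence rr: "r \<bullet> r > 0" by simp
    \<comment> \<open>A contradiction requires \<open>s * Q r < 2 * (r \<bullet> r)\<close>; this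
      \<open>s\<close> gives at most \<open>r \<bullet> r\<close>. The added 1 keeps the denominator
      positive when \<open>Q r = 0\<close>.\<close>
    define s where "s = (r \<bullet> r) / (Q r + 1)"
    have q1: "Q r + 1 > 0" using Q_nonneg[of r] by simp
    have s: "s > 0" using rr q1 by (simp add: s_def)
    have "s * Q r \<le> s * (Q r + 1)" using s by simp
    also have "\<dots> = r \<bullet> r" using q1 by (simp add: s_def)
    finally have "s * (s * Q r) \<le> s * (r \<bullet> r)" using s by simp
    moreover have "s * (r \<bullet> r) > 0" using s rr by simp
    ultimately show False
      using Q_nonneg[of "v - s *\<^sub>R r"] unfolding expand by (simp add: power2_eq_square mult.assoc)
  qed
  hence "M *v v = c *\<^sub>R v" by (simp add: r_def)
  moreover have "v \<noteq> 0" using v by auto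
  ultimately show ?thesis unfolding eigenvalue_def by blast
qed

lemma eigenvalue_smallest_eigenvalue:
  fixes M :: "real ^ 'n ^ 'n"
  assumes "transpose M = M"
  shows "eigenvalue M (smallest_eigenvalue M)"
  using Min_in[OF finite_eigenvalues_symmetric[OF assms]] eigenvalue_symmetric_exists[OF assms]
  unfolding smallest_eigenvalue_def by auto

text \<open>The order-reversing map \<open>\<mu> \<mapsto> 1 - \<mu>\<close> carries one spectrum
  onto the other, so it exchanges maximum and minimum.\<close>

lemma largest_eigenvalue_mat_1_diff:
  fixes M :: "real ^ 'n ^ 'n"
  assumes "transpose M = M"
  shows "largest_eigenvalue (mat 1 - M) = 1 - smallest_eigenvalue M"
proof -
  have iff: "eigenvalue (mat 1 - M) \<mu> \<longleftrightarrow> eigenvalue M (1 - \<mu>)" for \<mu>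
  proof -
    have "(mat 1 - M) *v v = \<mu> *\<^sub>R v \<longleftrightarrow> M *v v = (1 - \<mu>) *\<^sub>R v" for v
      by (auto simp: matrix_vector_mult_diff_rdistrib algebra_simps)
    thus ?thesis by (simp add: eigenvalue_def)
  qed
  have fin: "finite {\<mu>. eigenvalue M \<mu>}" by (rule finite_eigenvalues_symmetric[OF assms])
  have eq: "{\<mu>. eigenvalue (mat 1 - M) \<mu>} = (\<lambda>\<mu>. 1 - \<mu>) ` {\<mu>. eigenvalue M \<mu>}"
    unfolding iff by (force simp: image_iff)
  show ?thesis
    unfolding largest_eigenvalue_def
  proof (rule Max_eqI)
    show "finite {\<mu>. eigenvalue (mat 1 - M) \<mu>}" using fin eq by simp
    show "1 - smallest_eigenvalue M \<in> {\<mu>. eigenvalue (mat 1 - M) \<mu>}"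
      using eigenvalue_smallest_eigenvalue[OF assms] by (simp add: iff)
    fix \<mu> assume "\<mu> \<in> {\<mu>. eigenvalue (mat 1 - M) \<mu>}"
    hence "1 - \<mu> \<in> {\<mu>. eigenvalue M \<mu>}" by (simp add: iff)
    from Min_le[OF fin this] show "\<mu> \<le> 1 - smallest_eigenvalue M"
      by (simp add: smallest_eigenvalue_def)
  qed
qed

section \<open>The level set argument\<close>

lemma adj_commute: "adj E x y \<longleftrightarrow> adj E y x"
  by (simp add: adj_def insert_commute)

lemma transpose_norm_adj_matrix: "transpose (norm_adj_matrix E d) = norm_adj_matrix E d"
  by (simp add: transpose_def norm_adj_matrix_def adj_matrix_def vec_eq_iff adj_commute)

lemma beta_out_quotients_finite:
  "finite {real (non_isolated_count E L + non_isolated_count E R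
      + card (outer_boundary E (L \<union> R))) / real (card (L \<union> R)) | L R.
      L \<inter> R = {} \<and> L \<union> R \<noteq> {}}" (is "finite ?Q")
  for E :: "'v::finite set set"
proof -
  have "?Q \<subseteq> (\<lambda>(L, R). real (non_isolated_count E L + non_isolated_count E R
      + card (outer_boundary E (L \<union> R))) / real (card (L \<union> R))) ` UNIV" by auto
  thus ?thesis by (rule finite_subset) simp
qed

text \<open>Ensures that \<open>sqrt (1 + beta_out E) - 1\<close> is nonnegative, so that the final
  estimate may be squared.\<close>

lemma beta_out_nonneg: "beta_out E \<ge> 0" for E :: "'v::finite set set"
  unfolding beta_out_def
proof (rule Min.boundedI[OF beta_out_quotients_finite])
  have "\<exists>L R :: 'v set. L \<inter> R = {} \<and> L \<union> R \<noteq> {}" by (intro exI[of _ "{}"] exI[of _ UNIV]) simp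
  thus "{real (non_isolated_count E L + non_isolated_count E R
      + card (outer_boundary E (L \<union> R))) / real (card (L \<union> R)) | L R.
      L \<inter> R = {} \<and> L \<union> R \<noteq> {}} \<noteq> {}" by simp
qed (auto intro!: divide_nonneg_nonneg)

text \<open>Clearing the denominator makes the inequality valid for the empty pair too, which occurs
  at levels that no \<open>(f x)\<^sup>2\<close> exceeds.\<close>

lemma beta_out_le:
  fixes E :: "'v::finite set set"
  assumes "L \<inter> R = {}"
  shows "beta_out E * card (L \<union> R)
    \<le> non_isolated_count E L + non_isolated_count E R + card (outer_boundary E (L \<union> R))"
proof (cases "L \<union> R = {}")
  case False
  have "beta_out E \<le> real (non_isolated_count E L + non_isolated_count E R
      + card (outer_boundary E (L \<union> R))) / real (card (L \<union> R))"
    unfolding beta_out_def by (intro Min_le beta_out_quotients_finite) (use assms False in blast)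
  moreover have "card (L \<union> R) > 0" using False by (simp add: card_gt_0_iff)
  ultimately show ?thesis by (simp add: field_simps)
qed simp

text \<open>Integrate the hypothesis over the real line. The \<open>max\<close> accounts for empty
  intervals with \<open>b i < a i\<close>; the weights may have either sign.\<close>

lemma sum_indicator_intervals_nonneg:
  fixes a b c :: "'i \<Rightarrow> real"
  assumes "\<And>t. (\<Sum>i\<in>I. c i * indicator {a i..<b i} t) \<ge> 0"
  shows "(\<Sum>i\<in>I. c i * max 0 (b i - a i)) \<ge> 0"
proof -
  have int: "integrable lborel (\<lambda>t. c i * indicator {a i..<b i} t)" for i
    by (cases "a i \<le> b i") auto
  have "0 \<le> integral\<^sup>L lborel (\<lambda>t. \<Sum>i\<in>I. c i * indicator {a i..<b i} t)"
    by (rule integral_nonneg_AE) (use assms in simp)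
  also have "\<dots> = (\<Sum>i\<in>I. integral\<^sup>L lborel (\<lambda>t. c i * indicator {a i..<b i} t))"
    by (rule Bochner_Integration.integral_sum) (rule int)
  also have "\<dots> = (\<Sum>i\<in>I. c i * max 0 (b i - a i))"
  proof (rule sum.cong[OF refl])
    fix i
    show "integral\<^sup>L lborel (\<lambda>t. c i * indicator {a i..<b i} t) = c i * max 0 (b i - a i)"
      by (cases "a i \<le> b i") auto
  qed
  finally show ?thesis .
qed

text \<open>At level \<open>t\<close>, a vertex with a neighbour in its own level set has
  \<open>t\<close> below both \<open>(f x)\<^sup>2\<close> and \<open>p x\<close>, and a boundary
  vertex has \<open>t\<close> between \<open>(f x)\<^sup>2\<close> and \<open>q x\<close>. Each
  count in the numerator is thus at most the number of intervals containing \<open>t\<close>, and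
  integration replaces counts by total lengths.\<close>

lemma beta_out_layer_cake:
  fixes E :: "'v::finite set set" and f p q :: "'v \<Rightarrow> real"
  assumes p: "\<And>x y. adj E y x \<Longrightarrow> f x * f y > 0 \<Longrightarrow> (f y)\<^sup>2 \<le> p x"
    and q: "\<And>x y. adj E y x \<Longrightarrow> (f y)\<^sup>2 \<le> q x"
  shows "beta_out E * (\<Sum>x\<in>UNIV. (f x)\<^sup>2)
    \<le> (\<Sum>x\<in>UNIV. max 0 (min ((f x)\<^sup>2) (p x)) + max 0 (q x - (f x)\<^sup>2))"
proof -
  have "(\<Sum>x\<in>UNIV. - beta_out E * indicator {0..<(f x)\<^sup>2} t)
      + (\<Sum>x\<in>UNIV. 1 * indicator {0..<min ((f x)\<^sup>2) (p x)} t)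
      + (\<Sum>x\<in>UNIV. 1 * indicator {(f x)\<^sup>2..<q x} t) \<ge> 0" for t
  proof (cases "t \<ge> 0")
    case False
    hence "\<not> (f x)\<^sup>2 \<le> t" for x using zero_le_power2[of "f x"] by linarith
    with False show ?thesis by (simp add: indicator_def)
  next
    case True
    define L where "L = {x. f x > 0 \<and> (f x)\<^sup>2 > t}"
    define R where "R = {x. f x < 0 \<and> (f x)\<^sup>2 > t}"
    \<comment> \<open>As \<open>t \<ge> 0\<close>, vertices with \<open>f x = 0\<close> are not
      above the level, so splitting by sign loses none.\<close>
    have LR: "L \<union> R = {x. (f x)\<^sup>2 > t}"
      using True by (auto simp: L_def R_def) (metis linorder_neqE_linordered_idom not_le power_zero_numeral)
    have sum_card: "(\<Sum>x\<in>UNIV. indicator (A x) t) = real (card {x. t \<in> A x})" for A :: "'v \<Rightarrow> real set"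
      by (simp add: indicator_def of_bool_def flip: sum.inter_filter)
    have disj: "L \<inter> R = {}" by (auto simp: L_def R_def)
    have "non_isolated_count E L + non_isolated_count E R
        = card ({x\<in>L. \<exists>y\<in>L. adj E y x} \<union> {x\<in>R. \<exists>y\<in>R. adj E y x})"
      unfolding non_isolated_count_def using disj by (intro card_Un_disjoint[symmetric]) auto
    also have "\<dots> \<le> card {x. t \<in> {0..<min ((f x)\<^sup>2) (p x)}}"
    proof (rule card_mono)
      show "{x\<in>L. \<exists>y\<in>L. adj E y x} \<union> {x\<in>R. \<exists>y\<in>R. adj E y x}
          \<subseteq> {x. t \<in> {0..<min ((f x)\<^sup>2) (p x)}}"
        using True p by (fastforce simp: L_def R_def zero_less_mult_iff)
    qed simp
    finally have "non_isolated_count E L + non_isolated_count E R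
      \<le> card {x. t \<in> {0..<min ((f x)\<^sup>2) (p x)}}" .
    moreover have "card (outer_boundary E (L \<union> R)) \<le> card {x. t \<in> {(f x)\<^sup>2..<q x}}"
      unfolding LR using q by (intro card_mono) (fastforce simp: outer_boundary_def)+
    moreover have "card (L \<union> R) = card {x. t \<in> {0..<(f x)\<^sup>2}}"
      using True by (simp add: LR)
    ultimately show ?thesis
      using beta_out_le[OF disj, of E] sum_card[of "\<lambda>x. {0..<(f x)\<^sup>2}"]
        sum_card[of "\<lambda>x. {0..<min ((f x)\<^sup>2) (p x)}"] sum_card[of "\<lambda>x. {(f x)\<^sup>2..<q x}"]
      unfolding sum_distrib_left[symmetric] by simp
  qed
  note pos = this
  \<comment> \<open>The three sums are merged into one over pairs \<open>(k, x)\<close> so as to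
    integrate once: \<open>k = 0\<close> is the size of the level set with weight
    \<open>- beta_out E\<close>, \<open>k = 1\<close> the non-isolated vertices,
    \<open>k = 2\<close> the boundary.\<close>
  define c where "c k = (if k = 0 then - beta_out E else 1)" for k :: nat
  define a where "a k x = (if k = 2 then (f x)\<^sup>2 else 0)" for k :: nat and x
  define b where "b k x = (if k = 0 then (f x)\<^sup>2 else if k = 1 then min ((f x)\<^sup>2) (p x) else q x)"
    for k :: nat and x
  have "0 \<le> (\<Sum>(k, x)\<in>{0, 1, 2} \<times> UNIV. c k * indicator {a k x..<b k x} t)" for t
  proof -
    have "(\<Sum>(k, x)\<in>{0, 1, 2} \<times> UNIV. c k * indicator {a k x..<b k x} t)
      = (\<Sum>x\<in>UNIV. - beta_out E * indicator {0..<(f x)\<^sup>2} t)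
        + (\<Sum>x\<in>UNIV. 1 * indicator {0..<min ((f x)\<^sup>2) (p x)} t)
        + (\<Sum>x\<in>UNIV. 1 * indicator {(f x)\<^sup>2..<q x} t)"
      by (simp add: c_def a_def b_def add.assoc del: sum_mult_indicator flip: sum.cartesian_product)
    with pos[of t] show ?thesis by presburger
  qed
  hence "0 \<le> (\<Sum>(k, x)\<in>{0, 1, 2} \<times> UNIV. c k * max 0 (b k x - a k x))"
    using sum_indicator_intervals_nonneg[where I = "{0, 1, 2} \<times> UNIV" and c = "c \<circ> fst"
        and a = "\<lambda>(k, x). a k x" and b = "\<lambda>(k, x). b k x"]
    by (simp add: case_prod_unfold)
  thus ?thesis
    by (simp add: c_def a_def b_def sum.distrib sum_distrib_left sum_negf flip: sum.cartesian_product)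
qed

text \<open>A neighbour \<open>z\<close> of the same sign costs
  \<open>(f z)\<^sup>2 \<le> (f x + f z)\<^sup>2\<close>. A larger neighbour \<open>y\<close> of
  opposite sign costs \<open>(f x + f y)\<^sup>2\<close> plus a cross term, which gives the square
  root. Since \<open>y\<close> and \<open>z\<close> differ in sign they are distinct, so both
  squares fit into \<open>D2 x\<close> together.\<close>

lemma local_bound:
  fixes E :: "'v::finite set set" and f :: "'v \<Rightarrow> real"
  defines "p \<equiv> \<lambda>x. Max (insert 0 {(f y)\<^sup>2 | y. adj E y x \<and> f x * f y > 0})"
    and "q \<equiv> \<lambda>x. Max (insert 0 {(f y)\<^sup>2 | y. adj E y x})"
    and "D2 \<equiv> \<lambda>x. \<Sum>y | adj E y x. (f x + f y)\<^sup>2"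
  shows "max 0 (min ((f x)\<^sup>2) (p x)) + max 0 (q x - (f x)\<^sup>2) \<le> D2 x + 2 * (\<bar>f x\<bar> * sqrt (D2 x))"
proof -
  have D2_ge1: "(f x + f y)\<^sup>2 \<le> D2 x" if "adj E y x" for y
    unfolding D2_def using that by (intro member_le_sum) auto
  have D2_ge2: "(f x + f y)\<^sup>2 + (f x + f z)\<^sup>2 \<le> D2 x" if "adj E y x" "adj E z x" "y \<noteq> z" for y z
  proof -
    have "(\<Sum>w\<in>{y, z}. (f x + f w)\<^sup>2) \<le> D2 x"
      unfolding D2_def using that by (intro sum_mono2) auto
    thus ?thesis using that by simp
  qed
  have D2_nonneg: "D2 x \<ge> 0" unfolding D2_def by (intro sum_nonneg) simp
  have "p x \<in> insert 0 {(f y)\<^sup>2 | y. adj E y x \<and> f x * f y > 0}"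
    unfolding p_def by (rule Max_in) auto
  hence p: "p x = 0 \<or> (\<exists>y. adj E y x \<and> f x * f y > 0 \<and> p x = (f y)\<^sup>2)" by auto
  have "q x \<in> insert 0 {(f y)\<^sup>2 | y. adj E y x}"
    unfolding q_def by (rule Max_in) auto
  hence q: "q x = 0 \<or> (\<exists>y. adj E y x \<and> q x = (f y)\<^sup>2)" by auto
  have same: "(f y)\<^sup>2 \<le> (f x + f y)\<^sup>2" if "f x * f y \<ge> 0" for y
  proof -
    have "(f x + f y)\<^sup>2 = (f x)\<^sup>2 + 2 * (f x * f y) + (f y)\<^sup>2"
      by (simp add: power2_eq_square algebra_simps)
    thus ?thesis using that by simp
  qed
  have p_le: "p x \<le> D2 x"
    using p D2_nonneg by (metis D2_ge1 less_imp_le order_trans same)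
  have rest: "0 \<le> 2 * (\<bar>f x\<bar> * sqrt (D2 x))" using D2_nonneg by simp
  have p_nonneg: "p x \<ge> 0" using p by auto
  show ?thesis
  proof (cases "q x > (f x)\<^sup>2")
    case False
    have "max 0 (min ((f x)\<^sup>2) (p x)) \<le> p x" "max 0 (q x - (f x)\<^sup>2) = 0"
      using p_nonneg False by auto
    with p_le rest show ?thesis by linarith
  next
    case True
    hence "q x \<noteq> 0" using zero_le_power2[of "f x"] by linarith
    with q obtain y where y: "adj E y x" "q x = (f y)\<^sup>2" by blast
    show ?thesis
    proof (cases "f x * f y \<ge> 0")
      case nonneg: True
      \<comment> \<open>The cap of \<open>p x\<close> at \<open>(f x)\<^sup>2\<close> is essential
        here: the first summand is absorbed by the subtracted \<open>(f x)\<^sup>2\<close>, so a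
        single edge pays for both summands.\<close>
      have "max 0 (min ((f x)\<^sup>2) (p x)) + max 0 (q x - (f x)\<^sup>2) \<le> q x" using True by auto
      also have "\<dots> \<le> D2 x" using y D2_ge1[OF y(1)] same[OF nonneg] by simp
      finally show ?thesis using rest by linarith
    next
      case False
      \<comment> \<open>The signs are opposite and \<open>\<bar>f y\<bar> > \<bar>f x\<bar>\<close>,
        so the sum has the sign of \<open>f y\<close>.\<close>
      have abs: "\<bar>f x + f y\<bar> = \<bar>f y\<bar> - \<bar>f x\<bar>"
        using False True y(2) abs_le_square_iff[of "f y" "f x"]
        by (auto simp: mult_less_0_iff not_le)
      have *: "q x - (f x)\<^sup>2 = (f x + f y)\<^sup>2 + 2 * (\<bar>f x\<bar> * \<bar>f x + f y\<bar>)"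
      proof -
        have "q x - (f x)\<^sup>2 = (\<bar>f y\<bar> - \<bar>f x\<bar>)\<^sup>2 + 2 * (\<bar>f x\<bar> * (\<bar>f y\<bar> - \<bar>f x\<bar>))"
          unfolding y(2) power2_abs[of "f y", symmetric] power2_abs[of "f x", symmetric]
          by (simp only: power2_eq_square) (simp add: algebra_simps)
        thus ?thesis unfolding abs[symmetric] by simp
      qed
      have "\<bar>f x + f y\<bar> \<le> sqrt (D2 x)" using D2_ge1[OF y(1)] by (simp add: real_le_rsqrt)
      hence **: "2 * (\<bar>f x\<bar> * \<bar>f x + f y\<bar>) \<le> 2 * (\<bar>f x\<bar> * sqrt (D2 x))"
        by (simp add: mult_left_mono)
      have "max 0 (min ((f x)\<^sup>2) (p x)) + (f x + f y)\<^sup>2 \<le> D2 x"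
        using p
      proof
        assume "p x = 0"
        thus ?thesis using D2_ge1[OF y(1)] by simp
      next
        assume "\<exists>z. adj E z x \<and> f x * f z > 0 \<and> p x = (f z)\<^sup>2"
        then obtain z where z: "adj E z x" "f x * f z > 0" "p x = (f z)\<^sup>2" by blast
        have "z \<noteq> y" using z(2) False by auto
        moreover have "max 0 (min ((f x)\<^sup>2) (p x)) \<le> p x" using p_nonneg by auto
        ultimately show ?thesis
          using D2_ge2[OF z(1) y(1)] same[of z] z by linarith
      qed
      thus ?thesis using * ** True by simp
    qed
  qed
qed

section \<open>Summation over the vertices\<close>

lemma square_root_beta_out_bound:
  fixes E :: "'v::finite set set" and f :: "'v \<Rightarrow> real"
  shows "(sqrt (1 + beta_out E) - 1)\<^sup>2 * (\<Sum>x\<in>UNIV. (f x)\<^sup>2)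
    \<le> (\<Sum>x\<in>UNIV. \<Sum>y | adj E y x. (f x + f y)\<^sup>2)"
proof -
  define D2 where "D2 x = (\<Sum>y | adj E y x. (f x + f y)\<^sup>2)" for x
  define F where "F = sqrt (\<Sum>x\<in>UNIV. (f x)\<^sup>2)"
  define S where "S = sqrt (\<Sum>x\<in>UNIV. D2 x)"
  define \<beta> where "\<beta> = beta_out E"
  have \<beta>: "\<beta> \<ge> 0" unfolding \<beta>_def by (rule beta_out_nonneg)
  have D2: "D2 x \<ge> 0" for x unfolding D2_def by (intro sum_nonneg) simp
  have F2: "F\<^sup>2 = (\<Sum>x\<in>UNIV. (f x)\<^sup>2)" unfolding F_def by (simp add: sum_nonneg)
  have S2: "S\<^sup>2 = (\<Sum>x\<in>UNIV. D2 x)" unfolding S_def by (simp add: D2 sum_nonneg)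
  have F: "F \<ge> 0" and S: "S \<ge> 0" unfolding F_def S_def by (simp_all add: D2 sum_nonneg)
  \<comment> \<open>The bounds \<open>p\<close> and \<open>q\<close> are taken as the neighbour
    maxima. The inserted 0 is the default when no neighbour qualifies.\<close>
  have "\<beta> * F\<^sup>2 \<le> (\<Sum>x\<in>UNIV.
      max 0 (min ((f x)\<^sup>2) (Max (insert 0 {(f y)\<^sup>2 | y. adj E y x \<and> f x * f y > 0})))
      + max 0 (Max (insert 0 {(f y)\<^sup>2 | y. adj E y x}) - (f x)\<^sup>2))"
    unfolding F2 \<beta>_def by (rule beta_out_layer_cake) (auto intro!: Max_ge)
  also have "\<dots> \<le> (\<Sum>x\<in>UNIV. D2 x + 2 * (\<bar>f x\<bar> * sqrt (D2 x)))"
    unfolding D2_def by (intro sum_mono local_bound)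
  also have "\<dots> = S\<^sup>2 + 2 * (\<Sum>x\<in>UNIV. \<bar>f x\<bar> * sqrt (D2 x))"
    by (simp add: S2 sum.distrib sum_distrib_left)
  also have "(\<Sum>x\<in>UNIV. \<bar>f x\<bar> * sqrt (D2 x)) \<le> F * S"
    using L2_set_mult_ineq[of f "\<lambda>x. sqrt (D2 x)" UNIV]
    by (simp add: L2_set_def F_def S_def D2)
  \<comment> \<open>Adding \<open>F\<^sup>2\<close> to both sides of
    \<open>\<beta> * F\<^sup>2 \<le> S\<^sup>2 + 2 * (F * S)\<close> completes the square; this is
    the origin of \<open>1 + \<beta>\<close>.\<close>
  finally have "(1 + \<beta>) * F\<^sup>2 \<le> (S + F)\<^sup>2"
    by (simp add: power2_sum algebra_simps)
  hence "sqrt ((1 + \<beta>) * F\<^sup>2) \<le> S + F"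
    using F S by (intro real_le_lsqrt) auto
  moreover have "sqrt ((1 + \<beta>) * F\<^sup>2) = sqrt (1 + \<beta>) * F"
    using F by (simp add: real_sqrt_mult)
  ultimately have "(sqrt (1 + \<beta>) - 1) * F \<le> S"
    by (simp add: left_diff_distrib)
  moreover have "(sqrt (1 + \<beta>) - 1) * F \<ge> 0" using \<beta> F by simp
  ultimately have "((sqrt (1 + \<beta>) - 1) * F)\<^sup>2 \<le> S\<^sup>2" by (rule power_mono)
  thus ?thesis by (simp add: power_mult_distrib F2 S2 \<beta>_def D2_def)
qed

section \<open>The quadratic form of an eigenvector and the eigenvalue bound\<close>

lemma signless_dirichlet_form:
  fixes E :: "'v::finite set set" and v :: "real ^ 'v"
  assumes reg: "regular_graph E d" and d: "d \<ge> 1"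
    and ev: "norm_adj_matrix E d *v v = \<mu> *\<^sub>R v"
  shows "(\<Sum>x\<in>UNIV. \<Sum>y | adj E y x. (v $ x + v $ y)\<^sup>2)
    = 2 * real d * (1 + \<mu>) * (\<Sum>x\<in>UNIV. (v $ x)\<^sup>2)"
proof -
  have nb: "(\<Sum>y | adj E y x. v $ y) = d * \<mu> * v $ x" for x
  proof -
    have "\<mu> * v $ x = (norm_adj_matrix E d *v v) $ x" by (simp add: ev)
    also have "\<dots> = (\<Sum>y\<in>UNIV. if adj E y x then v $ y else 0) / d"
      unfolding matrix_vector_mult_def norm_adj_matrix_def adj_matrix_def sum_divide_distrib
      by (auto simp: adj_commute[of E x] intro!: sum.cong)
    also have "\<dots> = (\<Sum>y | adj E y x. v $ y) / d"
      by (simp add: sum.If_cases)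
    finally show ?thesis using d by (simp add: field_simps)
  qed
  have deg: "card {y. adj E y x} = d" for x
    using reg by (simp add: regular_graph_def vertex_degree_def)
  \<comment> \<open>Double counting: by regularity and symmetry of adjacency, each \<open>y\<close>
    is a neighbour of exactly \<open>d\<close> vertices.\<close>
  have swap: "(\<Sum>x\<in>UNIV. \<Sum>y | adj E y x. (v $ y)\<^sup>2) = d * (\<Sum>x\<in>UNIV. (v $ x)\<^sup>2)"
  proof -
    have "(\<Sum>x\<in>UNIV. \<Sum>y | adj E y x. (v $ y)\<^sup>2) = (\<Sum>y\<in>UNIV. \<Sum>x | adj E y x. (v $ y)\<^sup>2)"
      using sum.swap_restrict[of UNIV UNIV "\<lambda>x y. (v $ y)\<^sup>2" "\<lambda>x y. adj E y x"] by simp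
    also have "\<dots> = (\<Sum>y\<in>UNIV. d * (v $ y)\<^sup>2)"
    proof (rule sum.cong[OF refl])
      fix y
      have "{x. adj E y x} = {x. adj E x y}" by (rule Collect_cong) (rule adj_commute)
      hence "card {x. adj E y x} = d" using deg[of y] by metis
      thus "(\<Sum>x | adj E y x. (v $ y)\<^sup>2) = d * (v $ y)\<^sup>2" by simp
    qed
    finally show ?thesis by (simp add: sum_distrib_left)
  qed
  \<comment> \<open>After expansion the eigenvector equation turns the mixed term into
    \<open>2 * d * \<mu> * (v $ x)\<^sup>2\<close>. The neighbour squares are kept, since they
    simplify only after summing over \<open>x\<close>.\<close>
  have "(\<Sum>y | adj E y x. (v $ x + v $ y)\<^sup>2)
      = d * (1 + 2 * \<mu>) * (v $ x)\<^sup>2 + (\<Sum>y | adj E y x. (v $ y)\<^sup>2)" for x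
  proof -
    have "(\<Sum>y | adj E y x. (v $ x + v $ y)\<^sup>2)
        = (\<Sum>y | adj E y x. (v $ x)\<^sup>2) + (\<Sum>y | adj E y x. (v $ y)\<^sup>2)
          + 2 * v $ x * (\<Sum>y | adj E y x. v $ y)"
      by (simp only: power2_sum sum.distrib sum_distrib_left)
    thus ?thesis by (simp add: nb deg power2_eq_square algebra_simps)
  qed
  hence "(\<Sum>x\<in>UNIV. \<Sum>y | adj E y x. (v $ x + v $ y)\<^sup>2)
      = (\<Sum>x\<in>UNIV. d * (1 + 2 * \<mu>) * (v $ x)\<^sup>2 + (\<Sum>y | adj E y x. (v $ y)\<^sup>2))"
    by (rule sum.cong[OF refl])
  also have "\<dots> = d * (1 + 2 * \<mu>) * (\<Sum>x\<in>UNIV. (v $ x)\<^sup>2) + d * (\<Sum>x\<in>UNIV. (v $ x)\<^sup>2)"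
    unfolding sum.distrib swap sum_distrib_left[of "d * (1 + 2 * \<mu>)"] by (rule refl)
  also have "\<dots> = 2 * real d * (1 + \<mu>) * (\<Sum>x\<in>UNIV. (v $ x)\<^sup>2)"
    by (simp only: distrib_right[symmetric]) (simp add: distrib_left)
  finally show ?thesis .
qed

theorem mainTheorem4:
  fixes E :: "'v::finite set set" and d :: nat
  assumes "loop_graph E" and "regular_graph E d" and "d \<ge> 1"
  shows "2 - largest_eigenvalue (norm_laplacian E d)
           = 1 + smallest_eigenvalue (norm_adj_matrix E d) \<and>
         1 + smallest_eigenvalue (norm_adj_matrix E d)
           \<ge> (sqrt (1 + beta_out E) - 1)\<^sup>2 / (2 * real d)"
proof
  show "2 - largest_eigenvalue (norm_laplacian E d)
      = 1 + smallest_eigenvalue (norm_adj_matrix E d)"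
    unfolding norm_laplacian_def
    by (simp add: largest_eigenvalue_mat_1_diff[OF transpose_norm_adj_matrix])
  define t where "t = smallest_eigenvalue (norm_adj_matrix E d)"
  obtain v where v: "v \<noteq> 0" "norm_adj_matrix E d *v v = t *\<^sub>R v"
    using eigenvalue_smallest_eigenvalue[OF transpose_norm_adj_matrix, of E d]
    unfolding eigenvalue_def t_def by blast
  have "(\<Sum>x\<in>UNIV. (v $ x)\<^sup>2) = v \<bullet> v" by (simp add: inner_vec_def power2_eq_square)
  hence "(\<Sum>x\<in>UNIV. (v $ x)\<^sup>2) > 0" using v(1) by simp
  \<comment> \<open>The lower bound holds for every function; on an eigenvector for \<open>t\<close>
    its right side is known exactly, and the positive sum of squares cancels. The denominator
    \<open>2 * real d\<close> stems from this exact value.\<close>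
  moreover have "(sqrt (1 + beta_out E) - 1)\<^sup>2 * (\<Sum>x\<in>UNIV. (v $ x)\<^sup>2)
      \<le> 2 * real d * (1 + t) * (\<Sum>x\<in>UNIV. (v $ x)\<^sup>2)"
    using square_root_beta_out_bound[of E "\<lambda>x. v $ x"]
    unfolding signless_dirichlet_form[OF assms(2,3) v(2)] .
  ultimately have "(sqrt (1 + beta_out E) - 1)\<^sup>2 \<le> 2 * real d * (1 + t)" by simp
  thus "1 + smallest_eigenvalue (norm_adj_matrix E d)
      \<ge> (sqrt (1 + beta_out E) - 1)\<^sup>2 / (2 * real d)"
    using assms(3) by (simp add: t_def field_simps)
qed

end
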